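(* Let $G$ be a finite group and $s\ge 1$ an integer. Then $G$ is weakly $P_s$-stable if and only if $\mathrm{Pol}_s(G)$ is weakly stable in permutations.
   Context: For groups $G,H$, a map $f:G\to H$ and $g\in G$, define $\partial_g f:G\to H$ by $(\partial_g f)(x)=f(gx)f(x)^{-1}$, and put $\partial_{g_1,\ldots,g_k}f=\partial_{g_1}(\partial_{g_2}(\cdots\partial_{g_k}f))$. The map $f$ is polynomial of degree $\le s$ if $(\partial_{g_1,\ldots,g_{s+1}}f)(x)=1$ for all $x,g_1,\ldots,g_{s+1}\in G$; it is unital if $f(1)=1$. Universal polynomial group: let $F_G$ be the free group on the symbols $\{x_g : g\in G\setminus\{1\}\}$, set $x_1=1$, and let $\iota:G\to F_G$, $\iota(g)=x_g$. Let $R_s(G)$ be the normal closure in $F_G$ of all elements $(\partial_{g_1,\ldots,g_{s+1}}\iota)(1)$, $g_1,\ldots,g_{s+1}\in G$. Then $\mathrm{Pol}_s(G)=F_G/R_s(G)$. Since $G$ is finite, this is a finite presentation. $\mathrm{Sym}(m)$ carries the normalized Hamming distance $d_m(\sigma,\tau)=1-\frac1m|\mathrm{Fix}(\sigma^{-1}\tau)|$. Weak $P_s$-stability ($G$ finite): for a unital map $f:G\to\mathrm{Sym}(m)$ let $\widehat f:F_G\to\mathrm{Sym}(m)$ be the homomorphism with $\widehat f(x_g)=f(g)$ for all $g\in G$. Let $\ell$ be the word length on $F_G$ with respect to $\{x_g\}$. For $\delta>0$, $f$ is a $\delta$-strong polynomial approximation of degree at most $s$ if for every $w\in F_G$ with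 $\ell(w)<1/\delta$: $w\in R_s(G)$ implies $d_m(\widehat f(w),1)<\delta$, and $w\notin R_s(G)$ implies $d_m(\widehat f(w),1)>1-\delta$. $G$ is weakly $P_s$-stable if for every $\varepsilon>0$ there is $\delta>0$ such that for every $m$ and every $\delta$-strong polynomial approximation $f:G\to\mathrm{Sym}(m)$ of degree at most $s$ there is a unital polynomial map $q:G\to\mathrm{Sym}(m)$ of degree $\le s$ with $\max_{g\in G}d_m(f(g),q(g))<\varepsilon$. Weak stability in permutations (Arzhantseva–Păunescu): let $\Gamma=F/R$ be a finitely presented group, with $F$ free on $x_1,\ldots,x_k$ and $R$ the normal closure of finitely many elements. For $p=(p_1,\ldots,p_k)\in\mathrm{Sym}(m)^k$ let $\widehat p:F\to\mathrm{Sym}(m)$ be the homomorphism $x_i\mapsto p_i$. The tuple $p$ is a $\delta$-strong solution if for all $w\in F$ of word length $<1/\delta$: $w\in R$ implies $d_m(\widehat p(w),1)<\delta$, and $w\notin R$ implies $d_m(\widehat p(w),1)>1-\delta$. It is a solution if $R\le\ker\widehat p$. $\Gamma$ is weakly stable in permutations if for every $\varepsilon>0$ there is $\delta>0$ such that for every $m$ and every $\delta$-strong solution $p\in\mathrm{Sym}(m)^k$ there is a solution $p'\in\mathrm{Sym}(m)^k$ with $\max_i d_m(p_i,p_i')<\varepsilon$. (This property does not depend on the choice of finite presentation of $\Gamma$; for $\Gamma=\mathrm{Pol}_s(G)$ one may use the presentation $F_G/R_s(G)$.) *)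

theory Defs
  imports Complex_Main "HOL-Algebra.Sym_Groups"
begin

section \<open>Free groups\<close>

text \<open>The free group on \<open>X\<close> is realised on reduced words. The letter \<open>(x, True)\<close> stands for the
  generator \<open>x\<close> and \<open>(x, False)\<close> for its inverse, so that the word length of a group element with
  respect to \<open>X\<close> is the \<open>length\<close> of the list representing it.\<close>

type_synonym 'a word = "('a \<times> bool) list"

definition inv_letter :: "'a \<times> bool \<Rightarrow> 'a \<times> bool"
  where "inv_letter a = (fst a, \<not> snd a)"

definition reduced :: "'a word \<Rightarrow> bool"
  where "reduced w \<longleftrightarrow> successively (\<lambda>a b. b \<noteq> inv_letter a) w"

fun push :: "'a \<times> bool \<Rightarrow> 'a word \<Rightarrow> 'a word"
  where
    "push a [] = [a]"
  | "push a (b # w) = (if b = inv_letter a then w else a # b # w)"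

definition reduce :: "'a word \<Rightarrow> 'a word"
  where "reduce w = foldr push w []"

definition free_group :: "'a set \<Rightarrow> 'a word monoid"
  where "free_group X =
    \<lparr> carrier = {w. reduced w \<and> fst ` set w \<subseteq> X}, mult = (\<lambda>u v. reduce (u @ v)), one = [] \<rparr>"

text \<open>The homomorphism from the free group to \<open>H\<close> determined by the images \<open>p x\<close> of the generators;
  see \<open>word_val_hom\<close>, \<open>word_val_gen\<close> and \<open>word_val_unique\<close>.\<close>

definition word_val :: "('c, 'd) monoid_scheme \<Rightarrow> ('a \<Rightarrow> 'c) \<Rightarrow> 'a word \<Rightarrow> 'c"
  where "word_val H p w =
    foldr (\<lambda>(x, b) h. (if b then p x else inv\<^bsub>H\<^esub> (p x)) \<otimes>\<^bsub>H\<^esub> h) w \<one>\<^bsub>H\<^esub>"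

lemma inv_letter_inv_letter [simp]: "inv_letter (inv_letter a) = a"
  by (simp add: inv_letter_def)

lemma fst_inv_letter [simp]: "fst (inv_letter a) = fst a"
  by (simp add: inv_letter_def)

lemma reduced_Nil [simp]: "reduced []"
  by (simp add: reduced_def)

lemma reduced_Cons:
  "reduced (a # w) \<longleftrightarrow> reduced w \<and> (w = [] \<or> hd w \<noteq> inv_letter a)"
  by (auto simp: reduced_def successively_Cons)

lemma reduced_push: "reduced w \<Longrightarrow> reduced (push a w)"
  by (cases w) (auto simp: reduced_Cons)

lemma push_inv: "reduced w \<Longrightarrow> push a (push (inv_letter a) w) = w"
  by (cases w; cases "tl w") (auto simp: reduced_Cons)

lemma push_inv': "reduced w \<Longrightarrow> push (inv_letter a) (push a w) = w"
  using push_inv[of w "inv_letter a"] by simp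

lemma set_push: "set (push a w) \<subseteq> insert a (set w)"
  by (cases w) auto

lemma reduced_foldr: "reduced v \<Longrightarrow> reduced (foldr push u v)"
  by (induction u) (auto simp: reduced_push)

lemma reduced_reduce [simp]: "reduced (reduce w)"
  by (simp add: reduce_def reduced_foldr)

lemma set_reduce: "set (reduce w) \<subseteq> set w"
proof (induction w)
  case (Cons a w)
  then show ?case using set_push[of a "reduce w"] by (auto simp: reduce_def)
qed (simp add: reduce_def)

lemma reduce_reduced: "reduced w \<Longrightarrow> reduce w = w"
proof (induction w)
  case (Cons a w)
  then have "reduce (a # w) = push a w" by (simp add: reduce_def reduced_Cons)
  then show ?case using Cons.prems by (cases w) (auto simp: reduced_Cons)
qed (simp add: reduce_def)

lemma foldr_push_push:
  "reduced v \<Longrightarrow> foldr push (push a u) v = push a (foldr push u v)"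
  by (cases u) (auto simp: push_inv reduced_foldr)

lemma foldr_push_reduce: "reduced v \<Longrightarrow> foldr push (reduce u) v = foldr push u v"
  by (induction u) (auto simp: reduce_def foldr_push_push)

lemma reduce_append: "reduce (u @ v) = foldr push u (reduce v)"
  by (simp add: reduce_def)

lemma reduce_append_left: "reduce (reduce u @ v) = reduce (u @ v)"
  by (simp add: reduce_append foldr_push_reduce)

lemma reduce_append_right: "reduce (u @ reduce v) = reduce (u @ v)"
  by (simp add: reduce_append reduce_reduced)

lemma reduce_rev_append: "reduce (rev (map inv_letter w) @ w) = []"
proof (induction w)
  case (Cons a w)
  have "reduce (inv_letter a # a # w) = reduce w"
    using push_inv'[of "reduce w" a] by (simp add: reduce_def reduced_foldr)
  then show ?case
    using Cons by (simp add: reduce_append)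
qed (simp add: reduce_def)

lemma free_group_group: "group (free_group X)"
proof (rule groupI)
  fix u v assume "u \<in> carrier (free_group X)" "v \<in> carrier (free_group X)"
  then show "u \<otimes>\<^bsub>free_group X\<^esub> v \<in> carrier (free_group X)"
    using set_reduce[of "u @ v"] by (fastforce simp: free_group_def)
next
  fix u v w :: "'a word"
  show "u \<otimes>\<^bsub>free_group X\<^esub> v \<otimes>\<^bsub>free_group X\<^esub> w = u \<otimes>\<^bsub>free_group X\<^esub> (v \<otimes>\<^bsub>free_group X\<^esub> w)"
    by (simp add: free_group_def reduce_append_left reduce_append_right)
next
  fix w assume w: "w \<in> carrier (free_group X)"
  then show "\<one>\<^bsub>free_group X\<^esub> \<otimes>\<^bsub>free_group X\<^esub> w = w"
    by (simp add: free_group_def reduce_reduced)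
  have "reduce (reduce (rev (map inv_letter w)) @ w) = []"
    by (simp add: reduce_append_left reduce_rev_append)
  moreover have "reduce (rev (map inv_letter w)) \<in> carrier (free_group X)"
    using w set_reduce[of "rev (map inv_letter w)"] by (fastforce simp: free_group_def)
  ultimately show "\<exists>y\<in>carrier (free_group X). y \<otimes>\<^bsub>free_group X\<^esub> w = \<one>\<^bsub>free_group X\<^esub>"
    unfolding free_group_def
    by (intro bexI[of _ "reduce (rev (map inv_letter w))"]) simp_all
qed (simp add: free_group_def)

lemma free_group_gen: "x \<in> X \<Longrightarrow> [(x, True)] \<in> carrier (free_group X)"
  by (simp add: free_group_def reduced_Cons)

context
  fixes H :: "('c, 'd) monoid_scheme" and p :: "'a \<Rightarrow> 'c" and X :: "'a set"
  assumes H: "group H" and p: "p \<in> X \<rightarrow> carrier H"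
begin

interpretation H: group H by (rule H)

lemma p_closed: "x \<in> X \<Longrightarrow> p x \<in> carrier H"
  using p by blast

lemma word_val_closed: "fst ` set w \<subseteq> X \<Longrightarrow> word_val H p w \<in> carrier H"
  by (induction w) (auto simp: word_val_def p_closed)

lemma word_val_push:
  assumes "fst a \<in> X" "fst ` set w \<subseteq> X"
  shows "word_val H p (push a w) = word_val H p (a # w)"
proof (cases w)
  case (Cons b v)
  have v: "word_val H p v \<in> carrier H" and px: "p (fst a) \<in> carrier H"
    using assms Cons p by (auto intro!: word_val_closed)
  then show ?thesis
    using Cons by (cases a) (auto simp: word_val_def inv_letter_def simp flip: H.m_assoc)
qed simp

lemma word_val_reduce: "fst ` set w \<subseteq> X \<Longrightarrow> word_val H p (reduce w) = word_val H p w"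
proof (induction w)
  case (Cons a w)
  have "fst ` set (reduce w) \<subseteq> X" using Cons.prems set_reduce[of w] by auto
  then have "word_val H p (push a (reduce w)) = word_val H p (a # reduce w)"
    using Cons.prems by (intro word_val_push) auto
  then show ?case using Cons by (simp add: reduce_def word_val_def)
qed (simp add: reduce_def)

lemma word_val_append:
  "fst ` set u \<subseteq> X \<Longrightarrow> fst ` set v \<subseteq> X \<Longrightarrow>
    word_val H p (u @ v) = word_val H p u \<otimes>\<^bsub>H\<^esub> word_val H p v"
proof (induction u)
  case Nil
  then show ?case using word_val_closed[of v] by (simp add: word_val_def)
next
  case (Cons a u)
  have "word_val H p u \<in> carrier H" "word_val H p v \<in> carrier H" "p (fst a) \<in> carrier H"
    using Cons.prems p by (auto intro!: word_val_closed)
  then show ?case using Cons by (cases a) (auto simp: word_val_def H.m_assoc)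
qed

lemma word_val_hom: "word_val H p \<in> hom (free_group X) H"
proof (rule homI)
  fix u v assume "u \<in> carrier (free_group X)" "v \<in> carrier (free_group X)"
  then show "word_val H p (u \<otimes>\<^bsub>free_group X\<^esub> v) = word_val H p u \<otimes>\<^bsub>H\<^esub> word_val H p v"
    using word_val_reduce[of "u @ v"] by (simp add: free_group_def word_val_append image_Un)
qed (simp add: free_group_def word_val_closed)

lemma word_val_gen: "x \<in> X \<Longrightarrow> word_val H p [(x, True)] = p x"
  by (simp add: word_val_def p_closed)

lemma word_val_unique:
  assumes h: "h \<in> hom (free_group X) H" and gen: "\<And>x. x \<in> X \<Longrightarrow> h [(x, True)] = p x"
    and w: "w \<in> carrier (free_group X)"
  shows "h w = word_val H p w"
  using w
proof (induction w)
  interpret F: group "free_group X" by (rule free_group_group)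
  interpret h: group_hom "free_group X" H h
    using h by unfold_locales
  {
    case Nil
    show ?case using h.hom_one by (simp add: free_group_def word_val_def)
  next
    case (Cons a w)
    then have cl: "w \<in> carrier (free_group X)" "[a] \<in> carrier (free_group X)" "fst a \<in> X"
      by (auto simp: free_group_def reduced_Cons)
    have "reduced (a # w)" using Cons.prems by (simp add: free_group_def)
    then have split: "a # w = [a] \<otimes>\<^bsub>free_group X\<^esub> w"
      by (simp add: free_group_def reduce_reduced)
    have one: "h [a] = (if snd a then p (fst a) else inv\<^bsub>H\<^esub> (p (fst a)))"
    proof (cases "snd a")
      case True
      then show ?thesis using gen[OF cl(3)] by (cases a) auto
    next
      case False
      have g: "[(fst a, True)] \<in> carrier (free_group X)" using cl(3) by (rule free_group_gen)
      have "[a] \<otimes>\<^bsub>free_group X\<^esub> [(fst a, True)] = \<one>\<^bsub>free_group X\<^esub>"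
        using False by (cases a) (simp add: free_group_def reduce_def inv_letter_def)
      then have "inv\<^bsub>free_group X\<^esub> [(fst a, True)] = [a]"
        using F.inv_equality[OF _ g cl(2)] by simp
      then show ?thesis using False h.hom_inv[OF g] gen[OF cl(3)] by simp
    qed
    have "h (a # w) = h [a] \<otimes>\<^bsub>H\<^esub> h w"
      using h.hom_mult[OF cl(2,1)] split by simp
    then show ?case using one Cons.IH cl(1) by (cases a) (simp add: word_val_def)
  }
qed

end

definition normal_closure :: "('a, 'b) monoid_scheme \<Rightarrow> 'a set \<Rightarrow> 'a set"
  where "normal_closure G S = \<Inter> {N. N \<lhd> G \<and> S \<subseteq> N}"


section \<open>Polynomial maps and the universal polynomial group\<close>

definition fdiff :: "('a, 'b) monoid_scheme \<Rightarrow> ('c, 'd) monoid_scheme \<Rightarrow> 'a \<Rightarrow> ('a \<Rightarrow> 'c) \<Rightarrow> 'a \<Rightarrow> 'c"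
  where "fdiff G H g f = (\<lambda>x. f (g \<otimes>\<^bsub>G\<^esub> x) \<otimes>\<^bsub>H\<^esub> inv\<^bsub>H\<^esub> (f x))"

text \<open>For \<open>gs = [g\<^sub>1, \<dots>, g\<^sub>k]\<close> the difference along \<open>g\<^sub>k\<close> is taken first.\<close>

definition fdiffs ::
    "('a, 'b) monoid_scheme \<Rightarrow> ('c, 'd) monoid_scheme \<Rightarrow> 'a list \<Rightarrow> ('a \<Rightarrow> 'c) \<Rightarrow> 'a \<Rightarrow> 'c"
  where "fdiffs G H gs f = foldr (fdiff G H) gs f"

definition polynomial_map ::
    "('a, 'b) monoid_scheme \<Rightarrow> ('c, 'd) monoid_scheme \<Rightarrow> nat \<Rightarrow> ('a \<Rightarrow> 'c) \<Rightarrow> bool"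
  where "polynomial_map G H s f \<longleftrightarrow> f \<in> carrier G \<rightarrow> carrier H \<and>
    (\<forall>gs. length gs = s + 1 \<and> set gs \<subseteq> carrier G \<longrightarrow>
      (\<forall>x\<in>carrier G. fdiffs G H gs f x = \<one>\<^bsub>H\<^esub>))"

definition unital_map :: "('a, 'b) monoid_scheme \<Rightarrow> ('c, 'd) monoid_scheme \<Rightarrow> ('a \<Rightarrow> 'c) \<Rightarrow> bool"
  where "unital_map G H f \<longleftrightarrow> f \<in> carrier G \<rightarrow> carrier H \<and> f \<one>\<^bsub>G\<^esub> = \<one>\<^bsub>H\<^esub>"

definition pol_free :: "('a, 'b) monoid_scheme \<Rightarrow> 'a word monoid"
  where "pol_free G = free_group (carrier G - {\<one>\<^bsub>G\<^esub>})"

definition iota :: "('a, 'b) monoid_scheme \<Rightarrow> 'a \<Rightarrow> 'a word"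
  where "iota G g = (if g = \<one>\<^bsub>G\<^esub> then \<one>\<^bsub>pol_free G\<^esub> else [(g, True)])"

definition pol_relations :: "nat \<Rightarrow> ('a, 'b) monoid_scheme \<Rightarrow> 'a word set"
  where "pol_relations s G = normal_closure (pol_free G)
    {fdiffs G (pol_free G) gs (iota G) \<one>\<^bsub>G\<^esub> | gs. length gs = s + 1 \<and> set gs \<subseteq> carrier G}"

definition Pol :: "nat \<Rightarrow> ('a, 'b) monoid_scheme \<Rightarrow> 'a word set monoid"
  where "Pol s G = pol_free G Mod pol_relations s G"


section \<open>Weak stability\<close>

text \<open>Normalized Hamming distance on \<open>Sym(m)\<close>, acting on \<open>{1..m}\<close>; meaningful for \<open>m \<ge> 1\<close> only
  (the formula gives the value \<open>1\<close> for \<open>m = 0\<close>).\<close>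

definition hamming :: "nat \<Rightarrow> (nat \<Rightarrow> nat) \<Rightarrow> (nat \<Rightarrow> nat) \<Rightarrow> real"
  where "hamming m \<sigma> \<tau> =
    1 - real (card {i\<in>{1..m}. (inv\<^bsub>sym_group m\<^esub> \<sigma> \<otimes>\<^bsub>sym_group m\<^esub> \<tau>) i = i}) / real m"

definition strong_approx :: "'a set \<Rightarrow> 'a word set \<Rightarrow> real \<Rightarrow> nat \<Rightarrow> ('a \<Rightarrow> nat \<Rightarrow> nat) \<Rightarrow> bool"
  where "strong_approx X R \<delta> m p \<longleftrightarrow>
    (\<forall>w\<in>carrier (free_group X). real (length w) < 1 / \<delta> \<longrightarrow>
      (w \<in> R \<longrightarrow> hamming m (word_val (sym_group m) p w) \<one>\<^bsub>sym_group m\<^esub> < \<delta>) \<and>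
      (w \<notin> R \<longrightarrow> hamming m (word_val (sym_group m) p w) \<one>\<^bsub>sym_group m\<^esub> > 1 - \<delta>))"

definition strong_polynomial_approx ::
    "nat \<Rightarrow> ('a, 'b) monoid_scheme \<Rightarrow> real \<Rightarrow> nat \<Rightarrow> ('a \<Rightarrow> nat \<Rightarrow> nat) \<Rightarrow> bool"
  where "strong_polynomial_approx s G \<delta> m f \<longleftrightarrow> unital_map G (sym_group m) f \<and>
    strong_approx (carrier G - {\<one>\<^bsub>G\<^esub>}) (pol_relations s G) \<delta> m f"

definition weakly_P_stable :: "nat \<Rightarrow> ('a, 'b) monoid_scheme \<Rightarrow> bool"
  where "weakly_P_stable s G \<longleftrightarrow>
    (\<forall>\<epsilon>>0. \<exists>\<delta>>0. \<forall>m\<ge>1. \<forall>f. strong_polynomial_approx s G \<delta> m f \<longrightarrow>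
      (\<exists>q. unital_map G (sym_group m) q \<and> polynomial_map G (sym_group m) s q \<and>
        (\<forall>g\<in>carrier G. hamming m (f g) (q g) < \<epsilon>)))"

definition strong_solution :: "'a set \<Rightarrow> 'a word set \<Rightarrow> real \<Rightarrow> nat \<Rightarrow> ('a \<Rightarrow> nat \<Rightarrow> nat) \<Rightarrow> bool"
  where "strong_solution X R \<delta> m p \<longleftrightarrow>
    p \<in> X \<rightarrow> carrier (sym_group m) \<and> strong_approx X R \<delta> m p"

definition solution :: "'a set \<Rightarrow> 'a word set \<Rightarrow> nat \<Rightarrow> ('a \<Rightarrow> nat \<Rightarrow> nat) \<Rightarrow> bool"
  where "solution X R m p \<longleftrightarrow> p \<in> X \<rightarrow> carrier (sym_group m) \<and>
    R \<subseteq> kernel (free_group X) (sym_group m) (word_val (sym_group m) p)"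

definition weakly_stable_presentation :: "'a set \<Rightarrow> 'a word set \<Rightarrow> bool"
  where "weakly_stable_presentation X R \<longleftrightarrow>
    (\<forall>\<epsilon>>0. \<exists>\<delta>>0. \<forall>m\<ge>1. \<forall>p. strong_solution X R \<delta> m p \<longrightarrow>
      (\<exists>p'. solution X R m p' \<and> (\<forall>x\<in>X. hamming m (p x) (p' x) < \<epsilon>)))"

text \<open>The finite presentation of \<open>\<Gamma>\<close> may be chosen freely: weak stability does not depend on it.\<close>

definition weakly_stable_in_permutations :: "('a, 'b) monoid_scheme \<Rightarrow> bool"
  where "weakly_stable_in_permutations \<Gamma> \<longleftrightarrow>
    (\<exists>(k::nat) S. finite S \<and> S \<subseteq> carrier (free_group {1..k}) \<and>
      \<Gamma> \<cong> (free_group {1..k} Mod normal_closure (free_group {1..k}) S) \<and>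
      weakly_stable_presentation {1..k} (normal_closure (free_group {1..k}) S))"

end

theory Submission
  imports Defs
begin

text \<open>A unital map on \<open>G\<close> is a tuple indexed by \<open>G \<setminus> {1}\<close>, and \<open>\<partial>\<^sub>g h\<close> vanishes at \<open>1\<close> for every
  \<open>g\<close> only if \<open>h\<close> is constant. Hence unital polynomial maps of degree at most \<open>s\<close> into \<open>H\<close> are the
  solutions in \<open>H\<close> of the relations of \<open>Pol\<^sub>s(G)\<close>, and weak \<open>P\<^sub>s\<close>-stability is weak stability of the
  presentation \<open>F\<^sub>G / R\<^sub>s(G)\<close>. It remains to see that weak stability does not depend on the
  presentation: if \<open>\<pi>\<close> and \<open>\<rho>\<close> map the free groups on \<open>X\<close> and \<open>Y\<close> onto \<open>\<Gamma>\<close>, lift the generators to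
  words \<open>\<phi> x\<close> over \<open>Y\<close> and \<open>\<psi> y\<close> over \<open>X\<close>. Substituting \<open>\<psi>\<close> turns a strong solution over \<open>X\<close> into
  one over \<open>Y\<close>; substituting \<open>\<phi>\<close> turns a nearby solution over \<open>Y\<close> into one over \<open>X\<close>, which is close
  to the original tuple because each \<open>x\<inverse> \<psi>(\<phi> x)\<close> is a short relation.\<close>

section \<open>Words\<close>

lemma word_val_cong:
  assumes "\<And>x. x \<in> fst ` set w \<Longrightarrow> p x = q x"
  shows "word_val H p w = word_val H q w"
  using assms by (induction w) (auto simp: word_val_def)

lemma free_group_letters: "w \<in> carrier (free_group X) \<Longrightarrow> fst ` set w \<subseteq> X"
  by (simp add: free_group_def)

lemma word_val_in_carrier:
  assumes "group H" "p \<in> X \<rightarrow> carrier H" "w \<in> carrier (free_group X)"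
  shows "word_val H p w \<in> carrier H"
  using assms by (intro word_val_closed[of H p X]) (auto dest: free_group_letters)

text \<open>\<open>h\<close> after evaluation at \<open>p\<close> is a homomorphism on the free
  group and agrees with \<open>h \<circ> p\<close> on generators, so uniqueness applies. When
  \<open>H\<close> is itself a free group, evaluation in \<open>H\<close> is substitution of words,
  and this is the substitution rule.\<close>

lemma hom_word_val:
  assumes H: "group H" and K: "group K" and h: "h \<in> hom H K" and p: "p \<in> X \<rightarrow> carrier H"
    and w: "w \<in> carrier (free_group X)"
  shows "h (word_val H p w) = word_val K (h \<circ> p) w"
proof -
  have "h \<circ> word_val H p \<in> hom (free_group X) K"
    using word_val_hom[OF H p] h by (rule Group.hom_compose)
  moreover have "h \<circ> p \<in> X \<rightarrow> carrier K"
    using p h by (auto simp: hom_def)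
  ultimately show ?thesis
    using word_val_unique[OF K, of "h \<circ> p" X "h \<circ> word_val H p" w] w word_val_gen[OF H p]
    by simp
qed

text \<open>The identity is the homomorphism that fixes every generator.\<close>

lemma word_val_free_group_id:
  assumes "w \<in> carrier (free_group X)"
  shows "word_val (free_group X) (\<lambda>x. [(x, True)]) w = w"
proof -
  have "(\<lambda>w. w) \<in> hom (free_group X) (free_group X)"
    by (simp add: hom_def)
  then show ?thesis
    using word_val_unique[OF free_group_group, of "\<lambda>x. [(x, True)]" X X "\<lambda>w. w" w] assms
    by (auto simp: free_group_gen)
qed

section \<open>Word length and inverses in the free group\<close>

lemma length_push: "length (push a w) \<le> Suc (length w)"
  by (cases w) auto

lemma length_reduce: "length (reduce w) \<le> length w"
proof (induction w)
  case (Cons a w)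
  then show ?case using length_push[of a "reduce w"] by (simp add: reduce_def)
qed (simp add: reduce_def)

lemma length_free_group_mult: "length (u \<otimes>\<^bsub>free_group X\<^esub> v) \<le> length u + length v"
  using length_reduce[of "u @ v"] by (simp add: free_group_def)

lemma free_group_inv:
  assumes w: "w \<in> carrier (free_group X)"
  shows "inv\<^bsub>free_group X\<^esub> w = reduce (rev (map inv_letter w))"
proof (rule group.inv_equality[OF free_group_group _ w])
  show "reduce (rev (map inv_letter w)) \<otimes>\<^bsub>free_group X\<^esub> w = \<one>\<^bsub>free_group X\<^esub>"
    by (simp add: free_group_def reduce_append_left reduce_rev_append)
  show "reduce (rev (map inv_letter w)) \<in> carrier (free_group X)"
    using w set_reduce[of "rev (map inv_letter w)"] by (fastforce simp: free_group_def)
qed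

lemma length_free_group_inv:
  assumes "w \<in> carrier (free_group X)"
  shows "length (inv\<^bsub>free_group X\<^esub> w) \<le> length w"
  using length_reduce[of "rev (map inv_letter w)"] by (simp add: free_group_inv[OF assms])

text \<open>Reduction and inversion never lengthen a word, so each substituted letter contributes at
  most \<open>L\<close>.\<close>

lemma length_word_val_free_group:
  assumes p: "p \<in> Y \<rightarrow> carrier (free_group X)" and L: "\<And>y. y \<in> Y \<Longrightarrow> length (p y) \<le> L"
    and w: "fst ` set w \<subseteq> Y"
  shows "length (word_val (free_group X) p w) \<le> L * length w"
  using w
proof (induction w)
  case (Cons a w)
  obtain y b where a: "a = (y, b)" by (cases a)
  then have y: "p y \<in> carrier (free_group X)" "length (p y) \<le> L"
    using Cons.prems p L by auto
  let ?l = "if b then p y else inv\<^bsub>free_group X\<^esub> (p y)"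
  have "word_val (free_group X) p (a # w) = ?l \<otimes>\<^bsub>free_group X\<^esub> word_val (free_group X) p w"
    by (simp add: word_val_def a)
  moreover have "length ?l \<le> L"
    using y length_free_group_inv[OF y(1)] by auto
  ultimately show ?case
    using Cons length_free_group_mult[of X ?l "word_val (free_group X) p w"] by auto
qed (simp add: word_val_def free_group_def)


section \<open>Normal closures\<close>

lemma subset_normal_closure: "S \<subseteq> normal_closure G S"
  by (auto simp: normal_closure_def)

lemma normal_closure_subset: "N \<lhd> G \<Longrightarrow> S \<subseteq> N \<Longrightarrow> normal_closure G S \<subseteq> N"
  by (auto simp: normal_closure_def)

text \<open>The whole group is a normal subgroup containing \<open>S\<close>, so the intersection is
  over a nonempty family; an empty one would give \<open>UNIV\<close>.\<close>

lemma normal_closure_normal: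
  assumes G: "group G" and S: "S \<subseteq> carrier G"
  shows "normal_closure G S \<lhd> G"
proof -
  interpret group G by (rule G)
  have "carrier G \<lhd> G"
    by (simp add: normal_inv_iff subgroup_self)
  then have ne: "{N. N \<lhd> G \<and> S \<subseteq> N} \<noteq> {}"
    using S by auto
  have "subgroup (normal_closure G S) G"
    unfolding normal_closure_def using ne
    by (intro subgroups_Inter) (auto simp: normal_imp_subgroup)
  then show ?thesis
    unfolding normal_inv_iff by (auto simp: normal_closure_def normal_inv_iff)
qed

lemma kernel_normal:
  assumes "group G" "group H" "h \<in> hom G H"
  shows "kernel G H h \<lhd> G"
  using assms by (intro group_hom.normal_kernel group_hom.intro group_hom_axioms.intro)

text \<open>A coset \<open>N g\<close> equals \<open>N\<close> exactly when \<open>g\<close> lies in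
  \<open>N\<close>. Every normal subgroup thus becomes a kernel, the form in which relations enter
  the comparison of presentations.\<close>

lemma kernel_r_coset:
  assumes "group G" "N \<lhd> G"
  shows "kernel G (G Mod N) ((#>\<^bsub>G\<^esub>) N) = N"
proof -
  have N: "subgroup N G" using assms(2) by (rule normal_imp_subgroup)
  have "N #>\<^bsub>G\<^esub> g = N \<longleftrightarrow> g \<in> N" if "g \<in> carrier G" for g
    using group.coset_join1[OF assms(1) _ that N] group.coset_join2[OF assms(1) that N] by (intro iffI)
  moreover have "N \<subseteq> carrier G" using N by (rule subgroup.subset)
  ultimately show ?thesis
    by (auto simp: kernel_def)
qed

text \<open>The preimage of the normal closure of \<open>T\<close> is the kernel of \<open>h\<close>
  followed by the quotient map. It is therefore normal, and it contains \<open>S\<close>.\<close>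

lemma hom_normal_closure:
  assumes G: "group G" and H: "group H" and h: "h \<in> hom G H"
    and S: "S \<subseteq> carrier G" and T: "T \<subseteq> carrier H" and ST: "h ` S \<subseteq> normal_closure H T"
    and w: "w \<in> normal_closure G S"
  shows "h w \<in> normal_closure H T"
proof -
  let ?N = "normal_closure H T"
  have N: "?N \<lhd> H" by (rule normal_closure_normal[OF H T])
  define k where "k = (#>\<^bsub>H\<^esub>) ?N \<circ> h"
  have k: "k \<in> hom G (H Mod ?N)"
    unfolding k_def using h normal.r_coset_hom_Mod[OF N] by (rule Group.hom_compose)
  have ker: "kernel G (H Mod ?N) k = {g \<in> carrier G. h g \<in> ?N}"
    using kernel_r_coset[OF H N] h by (auto simp: k_def kernel_def hom_def)
  have "kernel G (H Mod ?N) k \<lhd> G"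
    using G normal.factorgroup_is_group[OF N] k by (rule kernel_normal)
  then have "normal_closure G S \<subseteq> {g \<in> carrier G. h g \<in> ?N}"
    using ST S by (intro normal_closure_subset) (auto simp: ker)
  then show ?thesis using w by auto
qed


section \<open>Differences and polynomial maps\<close>

lemma fdiffs_simps:
  "fdiffs G H [] f = f"
  "fdiffs G H (g # gs) f x = fdiffs G H gs f (g \<otimes>\<^bsub>G\<^esub> x) \<otimes>\<^bsub>H\<^esub> inv\<^bsub>H\<^esub> (fdiffs G H gs f x)"
  by (simp_all add: fdiffs_def fdiff_def)

lemma fdiffs_closed:
  assumes "group G" "group H" "f \<in> carrier G \<rightarrow> carrier H" "set gs \<subseteq> carrier G" "x \<in> carrier G"
  shows "fdiffs G H gs f x \<in> carrier H"
  using assms(4,5)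
proof (induction gs arbitrary: x)
  case Nil
  then show ?case using assms(3) by (auto simp: fdiffs_simps)
next
  case (Cons g gs)
  interpret G: group G by (rule assms)
  interpret H: group H by (rule assms)
  show ?case using Cons by (simp add: fdiffs_simps)
qed

text \<open>Differences are built from products and inverses, which \<open>h\<close> preserves.
  Agreement of \<open>f'\<close> with \<open>h\<close> after \<open>f\<close> is asked on the
  carrier only, the functions being total.\<close>

lemma hom_fdiffs:
  assumes "group G" "group H" "group K" and h: "h \<in> hom H K" and f: "f \<in> carrier G \<rightarrow> carrier H"
    and hf: "\<And>x. x \<in> carrier G \<Longrightarrow> h (f x) = f' x"
    and "set gs \<subseteq> carrier G" "x \<in> carrier G"
  shows "h (fdiffs G H gs f x) = fdiffs G K gs f' x"
  using assms(7,8)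
proof (induction gs arbitrary: x)
  case Nil
  then show ?case using hf by (simp add: fdiffs_simps)
next
  case (Cons g gs)
  interpret G: group G by (rule assms)
  interpret h: group_hom H K h
    using assms by (intro group_hom.intro group_hom_axioms.intro)
  have "fdiffs G H gs f (g \<otimes>\<^bsub>G\<^esub> x) \<in> carrier H" "fdiffs G H gs f x \<in> carrier H"
    using Cons.prems assms by (auto intro!: fdiffs_closed)
  then show ?case using Cons by (simp add: fdiffs_simps)
qed

text \<open>Relators are evaluated at the unit only, whereas polynomiality concerns all points. The
  gap closes because the outermost direction is free: if all differences of a map vanish at the
  unit, the map is constant.\<close>

lemma polynomial_map_iff_one:
  assumes "group G" "group H" and f: "f \<in> carrier G \<rightarrow> carrier H"
  shows "polynomial_map G H s f \<longleftrightarrow>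
    (\<forall>gs. length gs = s + 1 \<and> set gs \<subseteq> carrier G \<longrightarrow> fdiffs G H gs f \<one>\<^bsub>G\<^esub> = \<one>\<^bsub>H\<^esub>)"
    (is "_ \<longleftrightarrow> ?R")
proof
  interpret G: group G by (rule assms)
  interpret H: group H by (rule assms)
  show "polynomial_map G H s f \<Longrightarrow> ?R"
    by (simp add: polynomial_map_def)
  assume R: ?R
  have "fdiffs G H gs f x = \<one>\<^bsub>H\<^esub>"
    if gs: "length gs = s + 1" "set gs \<subseteq> carrier G" and x: "x \<in> carrier G" for gs x
  proof -
    obtain g hs where hs: "gs = g # hs" using gs by (cases gs) auto
    have cl: "fdiffs G H hs f y \<in> carrier H" if "y \<in> carrier G" for y
      using that gs hs assms by (intro fdiffs_closed) auto
    \<comment> \<open>With \<open>y\<close> as outermost direction, the hypothesis at the unit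
      compares the values of the inner difference at \<open>y\<close> and at the unit.\<close>
    have const: "fdiffs G H hs f y = fdiffs G H hs f \<one>\<^bsub>G\<^esub>" if y: "y \<in> carrier G" for y
    proof -
      have "fdiffs G H (y # hs) f \<one>\<^bsub>G\<^esub> = \<one>\<^bsub>H\<^esub>"
        using R gs hs y by auto
      then show ?thesis
        using cl y by (simp add: fdiffs_simps H.inv_solve_right')
    qed
    show ?thesis
      using const[of x] const[of "g \<otimes>\<^bsub>G\<^esub> x"] cl[of "\<one>\<^bsub>G\<^esub>"] x gs hs by (simp add: fdiffs_simps)
  qed
  then show "polynomial_map G H s f" using f by (simp add: polynomial_map_def)
qed

section \<open>The universal map and the relators of the polynomial group\<close>

lemma iota_closed: "iota G \<in> carrier G \<rightarrow> carrier (pol_free G)"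
  by (auto simp: iota_def pol_free_def free_group_gen group.is_monoid free_group_group
      intro!: monoid.one_closed)

text \<open>Unitality settles the case of the unit, which \<open>iota\<close> sends to the empty
  word.\<close>

lemma word_val_iota:
  assumes H: "group H" and f: "unital_map G H f" and x: "x \<in> carrier G"
  shows "word_val H f (iota G x) = f x"
proof (cases "x = \<one>\<^bsub>G\<^esub>")
  case True
  then show ?thesis
    using f by (simp add: iota_def pol_free_def free_group_def word_val_def unital_map_def)
next
  case False
  then show ?thesis
    using word_val_gen[OF H, of f "carrier G - {\<one>\<^bsub>G\<^esub>}" x] f x
    by (auto simp: iota_def unital_map_def)
qed

text \<open>The generating set inside \<open>pol_relations\<close> gets a name of its own because a
  presentation of \<open>Pol s G\<close> needs it to be finite.\<close>

definition pol_relators :: "nat \<Rightarrow> ('a, 'b) monoid_scheme \<Rightarrow> 'a word set"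
  where "pol_relators s G =
    {fdiffs G (pol_free G) gs (iota G) \<one>\<^bsub>G\<^esub> | gs. length gs = s + 1 \<and> set gs \<subseteq> carrier G}"

lemma pol_relations_eq: "pol_relations s G = normal_closure (pol_free G) (pol_relators s G)"
  by (simp add: pol_relations_def pol_relators_def)

lemma pol_free_group: "group (pol_free G)"
  by (simp add: pol_free_def free_group_group)

lemma pol_relators_closed: "group G \<Longrightarrow> pol_relators s G \<subseteq> carrier (pol_free G)"
  using fdiffs_closed[OF _ pol_free_group iota_closed, of G] group.is_monoid monoid.one_closed
  unfolding pol_relators_def by blast

lemma finite_pol_relators:
  assumes "finite (carrier G)"
  shows "finite (pol_relators s G)"
proof -
  have "finite {gs. set gs \<subseteq> carrier G \<and> length gs = s + 1}"
    using assms by (rule finite_lists_length_eq)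
  then have "finite ((\<lambda>gs. fdiffs G (pol_free G) gs (iota G) \<one>\<^bsub>G\<^esub>)
      ` {gs. set gs \<subseteq> carrier G \<and> length gs = s + 1})"
    by (rule finite_imageI)
  moreover have "pol_relators s G = (\<lambda>gs. fdiffs G (pol_free G) gs (iota G) \<one>\<^bsub>G\<^esub>)
      ` {gs. set gs \<subseteq> carrier G \<and> length gs = s + 1}"
    by (auto simp: pol_relators_def)
  ultimately show ?thesis by simp
qed

text \<open>The homomorphism extending \<open>f\<close> sends each relator to the corresponding
  difference of \<open>f\<close> at the unit. Its kernel is normal, so it contains the relators iff
  it contains their normal closure.\<close>

lemma polynomial_map_iff_kernel:
  assumes G: "group G" and H: "group H" and f: "unital_map G H f"
  shows "polynomial_map G H s f \<longleftrightarrow>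
    pol_relations s G \<subseteq> kernel (pol_free G) H (word_val H f)"
proof -
  have fc: "f \<in> carrier G \<rightarrow> carrier H" using f by (simp add: unital_map_def)
  then have "f \<in> carrier G - {\<one>\<^bsub>G\<^esub>} \<rightarrow> carrier H" by auto
  then have hom: "word_val H f \<in> hom (pol_free G) H"
    unfolding pol_free_def by (rule word_val_hom[OF H])
  have val: "word_val H f (fdiffs G (pol_free G) gs (iota G) \<one>\<^bsub>G\<^esub>) = fdiffs G H gs f \<one>\<^bsub>G\<^esub>"
    if "set gs \<subseteq> carrier G" for gs
    using that G H hom word_val_iota[OF H f] group.is_monoid[OF G]
    by (intro hom_fdiffs) (auto simp: pol_free_group iota_closed monoid.one_closed)
  have "polynomial_map G H s f \<longleftrightarrow> pol_relators s G \<subseteq> kernel (pol_free G) H (word_val H f)"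
    unfolding polynomial_map_iff_one[OF G H fc]
    using pol_relators_closed[OF G, of s] val
    by (fastforce simp: kernel_def pol_relators_def)
  also have "\<dots> \<longleftrightarrow> pol_relations s G \<subseteq> kernel (pol_free G) H (word_val H f)"
    using normal_closure_subset[OF kernel_normal[OF pol_free_group H hom]]
      subset_normal_closure[of "pol_relators s G" "pol_free G"]
    unfolding pol_relations_eq by blast
  finally show ?thesis .
qed


section \<open>The Hamming distance\<close>

text \<open>Counting disagreements replaces counting fixed points of the quotient: the inverse of
  \<sigma> sends \<tau> i to i iff \<sigma> i = \<tau> i.\<close>

lemma hamming_eq:
  assumes "m \<ge> 1" "\<sigma> \<in> carrier (sym_group m)"
  shows "hamming m \<sigma> \<tau> = card {i\<in>{1..m}. \<sigma> i \<noteq> \<tau> i} / m"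
proof -
  have "\<sigma> permutes {1..m}" using assms by (simp add: sym_group_carrier)
  then have "{i\<in>{1..m}. (inv\<^bsub>sym_group m\<^esub> \<sigma> \<otimes>\<^bsub>sym_group m\<^esub> \<tau>) i = i} = {i\<in>{1..m}. \<sigma> i = \<tau> i}"
    using assms by (auto simp: sym_group_mult permutes_inv_eq)
  moreover have "card {i\<in>{1..m}. \<sigma> i = \<tau> i} + card {i\<in>{1..m}. \<sigma> i \<noteq> \<tau> i} = m"
  proof -
    have "card ({i\<in>{1..m}. \<sigma> i = \<tau> i} \<union> {i\<in>{1..m}. \<sigma> i \<noteq> \<tau> i}) = card {1..m}"
      by (rule arg_cong[where f = card]) auto
    then show ?thesis by (subst (asm) card_Un_disjoint) auto
  qed
  then have "real (card {i\<in>{1..m}. \<sigma> i = \<tau> i}) = real m - card {i\<in>{1..m}. \<sigma> i \<noteq> \<tau> i}"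
    by linarith
  ultimately show ?thesis
    using assms by (simp add: hamming_def field_simps)
qed

lemma hamming_triangle:
  assumes m: "m \<ge> 1" and "\<sigma> \<in> carrier (sym_group m)" "\<tau> \<in> carrier (sym_group m)"
  shows "hamming m \<sigma> \<upsilon> \<le> hamming m \<sigma> \<tau> + hamming m \<tau> \<upsilon>"
proof -
  have "card {i\<in>{1..m}. \<sigma> i \<noteq> \<upsilon> i}
      \<le> card ({i\<in>{1..m}. \<sigma> i \<noteq> \<tau> i} \<union> {i\<in>{1..m}. \<tau> i \<noteq> \<upsilon> i})"
    by (intro card_mono) auto
  also have "\<dots> \<le> card {i\<in>{1..m}. \<sigma> i \<noteq> \<tau> i} + card {i\<in>{1..m}. \<tau> i \<noteq> \<upsilon> i}"
    by (rule card_Un_le)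
  finally have "real (card {i\<in>{1..m}. \<sigma> i \<noteq> \<upsilon> i})
      \<le> card {i\<in>{1..m}. \<sigma> i \<noteq> \<tau> i} + card {i\<in>{1..m}. \<tau> i \<noteq> \<upsilon> i}"
    by linarith
  then show ?thesis
    using assms by (simp add: hamming_eq field_simps)
qed

lemma hamming_refl: "m \<ge> 1 \<Longrightarrow> \<sigma> \<in> carrier (sym_group m) \<Longrightarrow> hamming m \<sigma> \<sigma> = 0"
  by (simp add: hamming_eq)

section \<open>Bi-invariance of the Hamming distance\<close>

lemma hamming_mult_left:
  assumes "m \<ge> 1" "\<rho> \<in> carrier (sym_group m)" "\<sigma> \<in> carrier (sym_group m)"
  shows "hamming m (\<rho> \<otimes>\<^bsub>sym_group m\<^esub> \<sigma>) (\<rho> \<otimes>\<^bsub>sym_group m\<^esub> \<tau>) = hamming m \<sigma> \<tau>"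
proof -
  have "inj \<rho>" using assms by (simp add: sym_group_carrier permutes_inj)
  moreover have "\<rho> \<otimes>\<^bsub>sym_group m\<^esub> \<sigma> \<in> carrier (sym_group m)"
    using assms by (intro monoid.m_closed group.is_monoid sym_group_is_group)
  ultimately show ?thesis
    using assms by (simp add: hamming_eq sym_group_mult inj_eq)
qed

lemma hamming_mult_right:
  assumes "m \<ge> 1" "\<rho> \<in> carrier (sym_group m)" "\<sigma> \<in> carrier (sym_group m)"
  shows "hamming m (\<sigma> \<otimes>\<^bsub>sym_group m\<^esub> \<rho>) (\<tau> \<otimes>\<^bsub>sym_group m\<^esub> \<rho>) = hamming m \<sigma> \<tau>"
proof -
  have \<rho>: "\<rho> permutes {1..m}" using assms by (simp add: sym_group_carrier)
  have "\<sigma> \<otimes>\<^bsub>sym_group m\<^esub> \<rho> \<in> carrier (sym_group m)"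
    using assms by (intro monoid.m_closed group.is_monoid sym_group_is_group)
  moreover have "card {i\<in>{1..m}. \<sigma> (\<rho> i) \<noteq> \<tau> (\<rho> i)} = card {i\<in>{1..m}. \<sigma> i \<noteq> \<tau> i}"
  proof (rule bij_betw_same_card)
    \<comment> \<open>The points of disagreement are relabelled by \<rho>, which permutes
      \<open>{1..m}\<close>.\<close>
    show "bij_betw \<rho> {i\<in>{1..m}. \<sigma> (\<rho> i) \<noteq> \<tau> (\<rho> i)} {i\<in>{1..m}. \<sigma> i \<noteq> \<tau> i}"
      using \<rho> permutes_in_image[OF \<rho>] permutes_inj_on[OF \<rho>] permutes_surj[OF \<rho>]
      by (auto simp: bij_betw_def image_iff) (metis surjD)
  qed
  ultimately show ?thesis
    using assms by (simp add: hamming_eq sym_group_mult)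
qed

lemma hamming_inv_mult_one:
  assumes "m \<ge> 1" "\<sigma> \<in> carrier (sym_group m)" "\<tau> \<in> carrier (sym_group m)"
  shows "hamming m (inv\<^bsub>sym_group m\<^esub> \<sigma> \<otimes>\<^bsub>sym_group m\<^esub> \<tau>) \<one>\<^bsub>sym_group m\<^esub> = hamming m \<sigma> \<tau>"
proof -
  interpret S: group "sym_group m" by (rule sym_group_is_group)
  have "\<sigma> permutes {1..m}" using assms by (simp add: sym_group_carrier)
  then have "{i\<in>{1..m}. (inv\<^bsub>sym_group m\<^esub> \<sigma> \<otimes>\<^bsub>sym_group m\<^esub> \<tau>) i \<noteq> \<one>\<^bsub>sym_group m\<^esub> i}
      = {i\<in>{1..m}. \<sigma> i \<noteq> \<tau> i}"
    using assms by (auto simp: sym_group_mult sym_group_one permutes_inv_eq)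
  then show ?thesis
    using assms S.m_closed[OF S.inv_closed] by (simp add: hamming_eq)
qed

lemma hamming_inv:
  assumes m: "m \<ge> 1" and \<sigma>: "\<sigma> \<in> carrier (sym_group m)" and \<tau>: "\<tau> \<in> carrier (sym_group m)"
  shows "hamming m (inv\<^bsub>sym_group m\<^esub> \<sigma>) (inv\<^bsub>sym_group m\<^esub> \<tau>) = hamming m \<sigma> \<tau>"
proof -
  interpret S: group "sym_group m" by (rule sym_group_is_group)
  \<comment> \<open>Right multiplication by \<tau> turns the second argument into the
    identity.\<close>
  have "hamming m (inv\<^bsub>sym_group m\<^esub> \<sigma>) (inv\<^bsub>sym_group m\<^esub> \<tau>)
      = hamming m (inv\<^bsub>sym_group m\<^esub> \<sigma> \<otimes>\<^bsub>sym_group m\<^esub> \<tau>) (inv\<^bsub>sym_group m\<^esub> \<tau> \<otimes>\<^bsub>sym_group m\<^esub> \<tau>)"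
    using m \<sigma> \<tau> by (simp only: hamming_mult_right S.inv_closed)
  then show ?thesis
    using assms by (simp add: S.l_inv hamming_inv_mult_one del: sym_group_inv_equality)
qed

text \<open>By bi-invariance and the triangle inequality, replacing \<open>p\<close> by
  \<open>q\<close> one letter at a time costs at most \<epsilon> per letter.\<close>

lemma hamming_word_val:
  fixes \<epsilon> :: real
  assumes m: "m \<ge> 1" and p: "p \<in> X \<rightarrow> carrier (sym_group m)"
    and q: "q \<in> X \<rightarrow> carrier (sym_group m)"
    and \<epsilon>: "\<And>x. x \<in> X \<Longrightarrow> hamming m (p x) (q x) \<le> \<epsilon>"
    and w: "fst ` set w \<subseteq> X"
  shows "hamming m (word_val (sym_group m) p w) (word_val (sym_group m) q w) \<le> length w * \<epsilon>"
  using w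
proof (induction w)
  interpret S: group "sym_group m" by (rule sym_group_is_group)
  let ?S = "sym_group m"
  {
    case Nil
    show ?case by (simp add: word_val_def hamming_refl[OF m])
  next
    case (Cons a w)
    obtain x b where a: "a = (x, b)" by (cases a)
    then have x: "x \<in> X" "p x \<in> carrier ?S" "q x \<in> carrier ?S"
      using Cons.prems p q by auto
    define l where "l f = (if b then f x else inv\<^bsub>?S\<^esub> (f x))" for f :: "'a \<Rightarrow> nat \<Rightarrow> nat"
    have val: "word_val ?S f (a # w) = l f \<otimes>\<^bsub>?S\<^esub> word_val ?S f w" for f
      by (simp add: word_val_def a l_def)
    have cl: "word_val ?S p w \<in> carrier ?S" "word_val ?S q w \<in> carrier ?S"
      using Cons.prems word_val_closed[OF S.is_group p] word_val_closed[OF S.is_group q] by auto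
    have lcl: "l p \<in> carrier ?S" "l q \<in> carrier ?S"
      using x by (auto simp: l_def simp del: sym_group_inv_equality)
    have "hamming m (l p) (l q) = hamming m (p x) (q x)"
      using m x by (simp add: l_def hamming_inv del: sym_group_inv_equality)
    then have ll: "hamming m (l p) (l q) \<le> \<epsilon>" using \<epsilon> x by simp
    \<comment> \<open>The intermediate permutation has its first letter already evaluated at
      \<open>q\<close> and the rest still at \<open>p\<close>.\<close>
    have "hamming m (word_val ?S p (a # w)) (word_val ?S q (a # w))
        \<le> hamming m (l p \<otimes>\<^bsub>?S\<^esub> word_val ?S p w) (l q \<otimes>\<^bsub>?S\<^esub> word_val ?S p w)
          + hamming m (l q \<otimes>\<^bsub>?S\<^esub> word_val ?S p w) (l q \<otimes>\<^bsub>?S\<^esub> word_val ?S q w)"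
      unfolding val using m cl lcl by (intro hamming_triangle) auto
    also have "\<dots> = hamming m (l p) (l q) + hamming m (word_val ?S p w) (word_val ?S q w)"
      using m cl lcl by (simp add: hamming_mult_left hamming_mult_right)
    also have "\<dots> \<le> \<epsilon> + length w * \<epsilon>"
      using ll Cons by (intro add_mono) auto
    finally show ?case by (simp add: algebra_simps)
  }
qed


section \<open>Independence of the presentation\<close>

text \<open>Surjectivity of \<rho> gives each generator a word over \<open>Y\<close> with the same
  image in \<Gamma>. The two homomorphisms then agree on generators, hence everywhere.\<close>

lemma lift_generators:
  assumes \<Gamma>: "group \<Gamma>" and \<pi>: "\<pi> \<in> hom (free_group X) \<Gamma>"
    and \<rho>: "\<rho> \<in> hom (free_group Y) \<Gamma>" "\<rho> ` carrier (free_group Y) = carrier \<Gamma>"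
  obtains \<phi> where "\<phi> \<in> X \<rightarrow> carrier (free_group Y)"
    and "\<And>w. w \<in> carrier (free_group X) \<Longrightarrow> \<rho> (word_val (free_group Y) \<phi> w) = \<pi> w"
proof -
  have "\<exists>v\<in>carrier (free_group Y). \<rho> v = \<pi> [(x, True)]" if "x \<in> X" for x
  proof -
    have "\<pi> [(x, True)] \<in> \<rho> ` carrier (free_group Y)"
      using that \<pi> \<rho>(2) free_group_gen[of x X] by (auto simp: hom_def)
    then show ?thesis by (metis imageE)
  qed
  then obtain \<phi> where \<phi>: "\<And>x. x \<in> X \<Longrightarrow> \<phi> x \<in> carrier (free_group Y) \<and> \<rho> (\<phi> x) = \<pi> [(x, True)]"
    by metis
  have cl: "\<phi> \<in> X \<rightarrow> carrier (free_group Y)" using \<phi> by blast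
  then have \<rho>\<phi>: "\<rho> \<circ> \<phi> \<in> X \<rightarrow> carrier \<Gamma>"
    using \<rho>(1) by (auto simp: hom_def)
  have "\<rho> (word_val (free_group Y) \<phi> w) = \<pi> w" if w: "w \<in> carrier (free_group X)" for w
  proof -
    have "\<rho> (word_val (free_group Y) \<phi> w) = word_val \<Gamma> (\<rho> \<circ> \<phi>) w"
      by (rule hom_word_val[OF free_group_group \<Gamma> \<rho>(1) cl w])
    also have "\<dots> = \<pi> w"
      using \<phi> by (intro word_val_unique[OF \<Gamma> \<rho>\<phi> \<pi> _ w, symmetric]) simp
    finally show ?thesis .
  qed
  then show ?thesis using that cl by blast
qed

lemma finite_length_bound:
  assumes "finite X"
  obtains L where "L \<ge> 1" "\<And>x. x \<in> X \<Longrightarrow> length (f x) \<le> L"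
proof
  \<comment> \<open>Inserting 1 keeps the maximum defined for empty \<open>X\<close> and makes the
    bound a legitimate divisor.\<close>
  show "Max (insert 1 ((\<lambda>x. length (f x)) ` X)) \<ge> 1"
    using assms by simp
  show "length (f x) \<le> Max (insert 1 ((\<lambda>x. length (f x)) ` X))" if "x \<in> X" for x
    using assms that by (intro Max_ge) auto
qed

text \<open>Relations are given as kernels of surjections onto one group \<Gamma>, so being a
  relation is a question about the image in \<Gamma>, and the roles of \<open>X\<close> and
  \<open>Y\<close> can be exchanged.\<close>

lemma weakly_stable_presentation_transfer:
  assumes finX: "finite X" and finY: "finite Y" and \<Gamma>: "group \<Gamma>"
    and \<pi>: "\<pi> \<in> hom (free_group X) \<Gamma>" "\<pi> ` carrier (free_group X) = carrier \<Gamma>"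
    and \<rho>: "\<rho> \<in> hom (free_group Y) \<Gamma>" "\<rho> ` carrier (free_group Y) = carrier \<Gamma>"
    and stable: "weakly_stable_presentation Y (kernel (free_group Y) \<Gamma> \<rho>)"
  shows "weakly_stable_presentation X (kernel (free_group X) \<Gamma> \<pi>)"
  unfolding weakly_stable_presentation_def
proof (intro allI impI)
  interpret FX: group "free_group X" by (rule free_group_group)
  interpret FY: group "free_group Y" by (rule free_group_group)
  interpret \<pi>: group_hom "free_group X" \<Gamma> \<pi>
    using \<pi> \<Gamma> FX.is_group by (intro group_hom.intro group_hom_axioms.intro)
  let ?R = "kernel (free_group X) \<Gamma> \<pi>" and ?Q = "kernel (free_group Y) \<Gamma> \<rho>"
  obtain \<phi> where \<phi>: "\<phi> \<in> X \<rightarrow> carrier (free_group Y)"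
      "\<And>w. w \<in> carrier (free_group X) \<Longrightarrow> \<rho> (word_val (free_group Y) \<phi> w) = \<pi> w"
    using lift_generators[OF \<Gamma> \<pi>(1) \<rho>] by blast
  obtain \<psi> where \<psi>: "\<psi> \<in> Y \<rightarrow> carrier (free_group X)"
      "\<And>w. w \<in> carrier (free_group Y) \<Longrightarrow> \<pi> (word_val (free_group X) \<psi> w) = \<rho> w"
    using lift_generators[OF \<Gamma> \<rho>(1) \<pi>] by blast
  obtain L1 where L1: "L1 \<ge> 1" "\<And>x. x \<in> X \<Longrightarrow> length (\<phi> x) \<le> L1"
    using finite_length_bound[OF finX] by blast
  obtain L2 where L2: "L2 \<ge> 1" "\<And>y. y \<in> Y \<Longrightarrow> length (\<psi> y) \<le> L2"
    using finite_length_bound[OF finY] by blast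
  fix \<epsilon> :: real assume \<epsilon>: "\<epsilon> > 0"
  \<comment> \<open>An error of \<epsilon>' per generator over \<open>Y\<close> grows to at most
    \<epsilon> / 2 on a word \<phi> x.\<close>
  define \<epsilon>' where "\<epsilon>' = \<epsilon> / (2 * L1)"
  have "\<epsilon>' > 0" using \<epsilon> L1 by (simp add: \<epsilon>'_def)
  then obtain \<delta>' where \<delta>': "\<delta>' > 0"
    and close: "\<And>m p. m \<ge> 1 \<Longrightarrow> strong_solution Y ?Q \<delta>' m p \<Longrightarrow>
      \<exists>p'. solution Y ?Q m p' \<and> (\<forall>y\<in>Y. hamming m (p y) (p' y) < \<epsilon>')"
    using stable unfolding weakly_stable_presentation_def by metis
  \<comment> \<open>The first bound keeps substituted words shorter than 1 / \<delta>; the second is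
    the other half of the final error; the third admits relations of length up to
    \<open>1 + L1 * L2\<close>, where the summand 2 yields the strict inequality.\<close>
  define \<delta> where "\<delta> = min (\<delta>' / L2) (min (\<epsilon> / 2) (1 / (L1 * L2 + 2)))"
  have pos: "\<delta> > 0" using \<delta>' \<epsilon> L2 by (simp add: \<delta>_def add_pos_nonneg)
  have bounds: "\<delta> \<le> \<delta>' / L2" "\<delta> \<le> \<epsilon> / 2" "\<delta> \<le> 1 / (L1 * L2 + 2)"
    by (simp_all only: \<delta>_def min.cobounded1 min.cobounded2 min.coboundedI2)
  have "\<delta>' / L2 \<le> \<delta>'" using L2 \<delta>' by (simp add: field_simps)
  then have \<delta>\<delta>': "\<delta> \<le> \<delta>'" using bounds by linarith
  have long: "L2 / \<delta>' \<le> 1 / \<delta>"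
    using bounds(1) pos \<delta>' L2 by (simp add: field_simps)
  have "0 < real L1 * L2 + 2" by (rule add_nonneg_pos) simp_all
  then have "real L1 * L2 + 2 \<le> 1 / \<delta>"
    using bounds(3) pos by (simp add: pos_le_divide_eq algebra_simps)
  then have short: "1 + real L1 * L2 < 1 / \<delta>" by linarith
  have "\<exists>q. solution X ?R m q \<and> (\<forall>x\<in>X. hamming m (p x) (q x) < \<epsilon>)"
    if m: "m \<ge> 1" and p: "strong_solution X ?R \<delta> m p" for m p
  proof -
    let ?S = "sym_group m"
    interpret S: group ?S by (rule sym_group_is_group)
    have pc: "p \<in> X \<rightarrow> carrier ?S" using p by (simp add: strong_solution_def)
    interpret P: group_hom "free_group X" ?S "word_val ?S p"
      using word_val_hom[OF S.is_group pc] by unfold_locales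
    have papprox: "(w \<in> ?R \<longrightarrow> hamming m (word_val ?S p w) \<one>\<^bsub>?S\<^esub> < \<delta>)
        \<and> (w \<notin> ?R \<longrightarrow> hamming m (word_val ?S p w) \<one>\<^bsub>?S\<^esub> > 1 - \<delta>)"
      if "w \<in> carrier (free_group X)" "length w < 1 / \<delta>" for w
      using p that by (simp add: strong_solution_def strong_approx_def)
    define p' where "p' = word_val ?S p \<circ> \<psi>"
    have p'c: "p' \<in> Y \<rightarrow> carrier ?S"
      using Pi_mem[OF \<psi>(1)] by (auto simp: p'_def)
    have p'val: "word_val ?S p' w = word_val ?S p (word_val (free_group X) \<psi> w)"
      if "w \<in> carrier (free_group Y)" for w
      unfolding p'_def using hom_word_val[OF FX.is_group S.is_group P.homh \<psi>(1) that] by simp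
    have \<psi>cl: "word_val (free_group X) \<psi> w \<in> carrier (free_group X)"
      if "w \<in> carrier (free_group Y)" for w
      using word_val_in_carrier[OF FX.is_group \<psi>(1) that] .
    have \<psi>len: "length (word_val (free_group X) \<psi> w) \<le> L2 * length w"
      if "w \<in> carrier (free_group Y)" for w
      using length_word_val_free_group[OF \<psi>(1) L2(2)] free_group_letters[OF that] by blast
    have "strong_approx Y ?Q \<delta>' m p'"
      unfolding strong_approx_def
    proof (intro ballI impI)
      fix w assume w: "w \<in> carrier (free_group Y)" and lw: "length w < 1 / \<delta>'"
      let ?v = "word_val (free_group X) \<psi> w"
      have "real (length ?v) \<le> real L2 * real (length w)"
        using \<psi>len[OF w] by (simp flip: of_nat_mult)
      also have "\<dots> < real L2 * (1 / \<delta>')"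
        using lw L2 by (intro mult_strict_left_mono) auto
      also have "\<dots> \<le> 1 / \<delta>" using long by simp
      finally have lv: "length ?v < 1 / \<delta>" .
      \<comment> \<open>An equivalence is required: relations must stay near the identity and
        non-relations must stay far from it.\<close>
      have "?v \<in> ?R \<longleftrightarrow> w \<in> ?Q"
        using \<psi>cl[OF w] \<psi>(2)[OF w] w by (simp add: kernel_def)
      then show "(w \<in> ?Q \<longrightarrow> hamming m (word_val ?S p' w) \<one>\<^bsub>?S\<^esub> < \<delta>') \<and>
          (w \<notin> ?Q \<longrightarrow> hamming m (word_val ?S p' w) \<one>\<^bsub>?S\<^esub> > 1 - \<delta>')"
        using papprox[OF \<psi>cl[OF w] lv] \<delta>\<delta>' p'val[OF w] by auto
    qed
    then have "strong_solution Y ?Q \<delta>' m p'" using p'c by (simp add: strong_solution_def)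
    then obtain q' where q': "solution Y ?Q m q'" "\<And>y. y \<in> Y \<Longrightarrow> hamming m (p' y) (q' y) < \<epsilon>'"
      using close[OF m] by blast
    have q'c: "q' \<in> Y \<rightarrow> carrier ?S" using q' by (simp add: solution_def)
    interpret Q': group_hom "free_group Y" ?S "word_val ?S q'"
      using word_val_hom[OF S.is_group q'c] by unfold_locales
    define q where "q = word_val ?S q' \<circ> \<phi>"
    have qc: "q \<in> X \<rightarrow> carrier ?S"
      using Pi_mem[OF \<phi>(1)] by (auto simp: q_def)
    have qval: "word_val ?S q w = word_val ?S q' (word_val (free_group Y) \<phi> w)"
      if "w \<in> carrier (free_group X)" for w
      unfolding q_def using hom_word_val[OF FY.is_group S.is_group Q'.homh \<phi>(1) that] by simp
    have "solution X ?R m q"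
      unfolding solution_def
    proof (intro conjI subsetI)
      fix w assume w: "w \<in> ?R"
      then have wc: "w \<in> carrier (free_group X)" by (simp add: kernel_def)
      \<comment> \<open>Substituting \<phi> preserves the image in \<Gamma>, so relations over
        \<open>X\<close> become relations over \<open>Y\<close>, where \<open>q'\<close> is
        exact.\<close>
      have "word_val (free_group Y) \<phi> w \<in> ?Q"
        using w wc \<phi>(2)[OF wc] word_val_in_carrier[OF FY.is_group \<phi>(1) wc]
        by (simp add: kernel_def)
      then have "word_val ?S q' (word_val (free_group Y) \<phi> w) = \<one>\<^bsub>?S\<^esub>"
        using q'(1) by (auto simp: solution_def kernel_def)
      then show "w \<in> kernel (free_group X) ?S (word_val ?S q)"
        using wc qval by (simp add: kernel_def)
    qed (rule qc)
    moreover have "hamming m (p x) (q x) < \<epsilon>" if x: "x \<in> X" for x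
    proof -
      let ?x = "[(x, True)]" and ?v = "word_val (free_group X) \<psi> (\<phi> x)"
      \<comment> \<open>Since \<open>x\<close> and its double substitution have the same image in
        \<Gamma>, this is a relation. It is short, so \<open>p\<close> nearly kills it, which places
        \<open>p x\<close> near the value of \<open>p'\<close> on \<phi> x.\<close>
      let ?r = "inv\<^bsub>free_group X\<^esub> ?x \<otimes>\<^bsub>free_group X\<^esub> ?v"
      have xc: "?x \<in> carrier (free_group X)" using x by (rule free_group_gen)
      have \<phi>x: "\<phi> x \<in> carrier (free_group Y)" using \<phi>(1) x by auto
      have \<phi>gen: "word_val (free_group Y) \<phi> ?x = \<phi> x"
        using word_val_gen[OF FY.is_group \<phi>(1) x] .
      have px: "word_val ?S p ?x = p x" using word_val_gen[OF S.is_group pc x] .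
      have \<pi>v: "\<pi> ?v = \<pi> ?x"
        using \<psi>(2)[OF \<phi>x] \<phi>(2)[OF xc] \<phi>gen by simp
      have rR: "?r \<in> ?R"
        using xc \<psi>cl[OF \<phi>x] \<pi>v by (simp add: kernel_def)
      have "L2 * length (\<phi> x) \<le> L1 * L2"
        using L1(2)[OF x] by (simp add: mult.commute[of L1])
      moreover have "length (inv\<^bsub>free_group X\<^esub> ?x) \<le> 1"
        using length_free_group_inv[OF xc] by simp
      ultimately have "length ?r \<le> 1 + L1 * L2"
        using length_free_group_mult[of X "inv\<^bsub>free_group X\<^esub> ?x" ?v] \<psi>len[OF \<phi>x]
        by linarith
      then have "real (length ?r) \<le> 1 + real L1 * L2"
        by (metis of_nat_1 of_nat_add of_nat_le_iff of_nat_mult)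
      then have "hamming m (word_val ?S p ?r) \<one>\<^bsub>?S\<^esub> < \<delta>"
        using papprox[of ?r] rR short by (auto simp: kernel_def)
      moreover have "word_val ?S p ?r = inv\<^bsub>?S\<^esub> (p x) \<otimes>\<^bsub>?S\<^esub> word_val ?S p' (\<phi> x)"
        using xc \<psi>cl[OF \<phi>x] px p'val[OF \<phi>x] by (simp del: sym_group_inv_equality)
      moreover have cl: "p x \<in> carrier ?S" "word_val ?S p' (\<phi> x) \<in> carrier ?S"
        using pc x word_val_in_carrier[OF S.is_group p'c \<phi>x] by auto
      ultimately have 1: "hamming m (p x) (word_val ?S p' (\<phi> x)) < \<delta>"
        using hamming_inv_mult_one[OF m cl] by simp
      have "hamming m (word_val ?S p' (\<phi> x)) (q x) \<le> length (\<phi> x) * \<epsilon>'"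
        unfolding q_def comp_def using q'(2) free_group_letters[OF \<phi>x]
        by (intro hamming_word_val[OF m p'c q'c]) (auto intro: less_imp_le)
      also have "\<dots> \<le> L1 * \<epsilon>'"
        using L1(2)[OF x] \<open>\<epsilon>' > 0\<close> by (intro mult_right_mono) auto
      also have "\<dots> = \<epsilon> / 2" using L1 by (simp add: \<epsilon>'_def)
      finally show ?thesis
        using 1 bounds(2) hamming_triangle[OF m cl, of "q x"] by linarith
    qed
    ultimately show ?thesis by blast
  qed
  then show "\<exists>\<delta>>0. \<forall>m\<ge>1. \<forall>p. strong_solution X ?R \<delta> m p \<longrightarrow>
      (\<exists>p'. solution X ?R m p' \<and> (\<forall>x\<in>X. hamming m (p x) (p' x) < \<epsilon>))"
    using pos by blast
qed

section \<open>Passage between presentations and abstract groups\<close>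

lemma stable_presentation_imp_weakly_stable:
  assumes finX: "finite X" and finS: "finite S" and S: "S \<subseteq> carrier (free_group X)"
    and stable: "weakly_stable_presentation X (normal_closure (free_group X) S)"
  shows "weakly_stable_in_permutations (free_group X Mod normal_closure (free_group X) S)"
proof -
  let ?N = "normal_closure (free_group X) S" and ?k = "card X"
  let ?\<Gamma> = "free_group X Mod ?N" and ?Y = "{1..?k}"
  let ?FX = "free_group X" and ?FY = "free_group {1..?k}"
  have FX: "group ?FX" and FY: "group ?FY" by (rule free_group_group)+
  have N: "?N \<lhd> ?FX" by (rule normal_closure_normal[OF FX S])
  then have \<Gamma>: "group ?\<Gamma>" by (rule normal.factorgroup_is_group)
  \<comment> \<open>Weak stability of a group asks for a presentation on generators
    \<open>{1..k}\<close>, so the elements of \<open>X\<close> are numbered. The relabelling extends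
    to mutually inverse homomorphisms \<open>h\<close> and \<open>h'\<close>.\<close>
  obtain b where b: "bij_betw b X ?Y"
    using finX by (metis card_atLeastAtMost diff_Suc_1 finite_same_card_bij
        finite_atLeastAtMost)
  define c where "c = inv_into X b"
  have bc: "c y \<in> X" "b (c y) = y" if "y \<in> ?Y" for y
    using b that by (auto simp: c_def bij_betw_def inv_into_into f_inv_into_f)
  have cb: "b x \<in> ?Y" "c (b x) = x" if "x \<in> X" for x
    using b that by (auto simp: c_def bij_betw_def inv_into_f_f)
  define h where "h = word_val ?FY (\<lambda>x. [(b x, True)])"
  define h' where "h' = word_val ?FX (\<lambda>y. [(c y, True)])"
  have gb: "(\<lambda>x. [(b x, True)]) \<in> X \<rightarrow> carrier ?FY" using cb by (auto intro: free_group_gen)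
  have gc: "(\<lambda>y. [(c y, True)]) \<in> ?Y \<rightarrow> carrier ?FX"
    using bc by (auto intro!: free_group_gen)
  have h: "h \<in> hom ?FX ?FY" unfolding h_def by (rule word_val_hom[OF FY gb])
  have h': "h' \<in> hom ?FY ?FX" unfolding h'_def by (rule word_val_hom[OF FX gc])
  have hc: "h w \<in> carrier ?FY" if "w \<in> carrier ?FX" for w using h that by (auto simp: hom_def)
  have hc': "h' w \<in> carrier ?FX" if "w \<in> carrier ?FY" for w using h' that by (auto simp: hom_def)
  have h'h: "h' (h w) = w" if w: "w \<in> carrier ?FX" for w
  proof -
    have "h' (h w) = word_val ?FX (h' \<circ> (\<lambda>x. [(b x, True)])) w"
      unfolding h_def by (rule hom_word_val[OF FY FX h' gb w])
    also have "\<dots> = word_val ?FX (\<lambda>x. [(x, True)]) w"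
      using free_group_letters[OF w] cb word_val_gen[OF FX gc]
      by (intro word_val_cong) (auto simp: h'_def subset_iff)
    finally show ?thesis using word_val_free_group_id[OF w] by simp
  qed
  have hh': "h (h' w) = w" if w: "w \<in> carrier ?FY" for w
  proof -
    have "h (h' w) = word_val ?FY (h \<circ> (\<lambda>y. [(c y, True)])) w"
      unfolding h'_def by (rule hom_word_val[OF FX FY h gc w])
    also have "\<dots> = word_val ?FY (\<lambda>x. [(x, True)]) w"
    proof (rule word_val_cong)
      fix y assume "y \<in> fst ` set w"
      then have "y \<in> ?Y" using free_group_letters[OF w] by blast
      then show "(h \<circ> (\<lambda>y. [(c y, True)])) y = [(y, True)]"
        using bc[of y] word_val_gen[OF FY gb, of "c y"] by (simp add: h_def)
    qed
    finally show ?thesis using word_val_free_group_id[OF w] by simp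
  qed
  define T where "T = h ` S"
  have T: "T \<subseteq> carrier ?FY" using S hc by (auto simp: T_def)
  let ?M = "normal_closure ?FY T"
  define \<rho> where "\<rho> = (#>\<^bsub>?FX\<^esub>) ?N \<circ> h'"
  have \<pi>: "(#>\<^bsub>?FX\<^esub>) ?N \<in> hom ?FX ?\<Gamma>" by (rule normal.r_coset_hom_Mod[OF N])
  have \<pi>surj: "(#>\<^bsub>?FX\<^esub>) ?N ` carrier ?FX = carrier ?\<Gamma>" by (simp add: carrier_FactGroup)
  have \<rho>: "\<rho> \<in> hom ?FY ?\<Gamma>" unfolding \<rho>_def using h' \<pi> by (rule Group.hom_compose)
  have "h' ` carrier ?FY = carrier ?FX"
  proof (intro equalityI subsetI)
    show "w \<in> h' ` carrier ?FY" if "w \<in> carrier ?FX" for w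
      using hc[OF that] h'h[OF that] by (intro image_eqI[of _ _ "h w"]) simp_all
  qed (use hc' in auto)
  then have \<rho>surj: "\<rho> ` carrier ?FY = carrier ?\<Gamma>"
    by (simp only: \<rho>_def \<pi>surj flip: image_comp)
  \<comment> \<open>As \<open>h\<close> and \<open>h'\<close> exchange \<open>S\<close> and
    \<open>T\<close>, they exchange the normal closures. This identifies the kernel of \<rho>, and
    the first isomorphism theorem then shows that \<open>T\<close> presents the same group.\<close>
  have hN: "h w \<in> ?M" if "w \<in> ?N" for w
    using hom_normal_closure[OF FX FY h S T _ that] subset_normal_closure[of T ?FY]
    by (simp add: T_def)
  have "h' ` T \<subseteq> S" using S h'h by (auto simp: T_def)
  then have h'N: "h' w \<in> ?N" if "w \<in> ?M" for w
    using hom_normal_closure[OF FY FX h' T S _ that] subset_normal_closure[of S ?FX] by blast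
  have Mcl: "?M \<subseteq> carrier ?FY"
    using normal_closure_normal[OF FY T] by (meson normal_imp_subgroup subgroup.subset)
  have "kernel ?FY ?\<Gamma> \<rho> = {w \<in> carrier ?FY. h' w \<in> ?N}"
    using kernel_r_coset[OF FX N] hc' by (auto simp: \<rho>_def kernel_def)
  also have "\<dots> = ?M"
  proof (intro equalityI subsetI)
    show "w \<in> ?M" if "w \<in> {w \<in> carrier ?FY. h' w \<in> ?N}" for w
      using that hN[of "h' w"] hh'[of w] by simp
  qed (use h'N Mcl in auto)
  finally have ker: "kernel ?FY ?\<Gamma> \<rho> = ?M" .
  interpret \<rho>: group_hom ?FY ?\<Gamma> \<rho>
    using FY \<Gamma> \<rho> by (intro group_hom.intro group_hom_axioms.intro)
  have "?FY Mod ?M \<cong> ?\<Gamma>"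
    using \<rho>.FactGroup_iso[OF \<rho>surj] unfolding ker .
  then have iso: "?\<Gamma> \<cong> ?FY Mod ?M"
    using group.iso_sym normal.factorgroup_is_group[OF normal_closure_normal[OF FY T]] by blast
  \<comment> \<open>The transfer runs from \<open>X\<close> to the numbered generators, with the
    quotient map of \<open>X\<close> as the stable side.\<close>
  have "weakly_stable_presentation ?Y ?M"
    using weakly_stable_presentation_transfer[OF _ finX \<Gamma> \<rho> \<rho>surj \<pi> \<pi>surj] stable
    unfolding ker kernel_r_coset[OF FX N] by blast
  then show ?thesis
    unfolding weakly_stable_in_permutations_def using iso T finS
    by (intro exI[of _ ?k] exI[of _ T]) (auto simp: T_def)
qed

lemma weakly_stable_imp_stable_presentation:
  assumes finX: "finite X" and S: "S \<subseteq> carrier (free_group X)"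
    and stable: "weakly_stable_in_permutations (free_group X Mod normal_closure (free_group X) S)"
  shows "weakly_stable_presentation X (normal_closure (free_group X) S)"
proof -
  let ?N = "normal_closure (free_group X) S" and ?FX = "free_group X"
  let ?\<Gamma> = "?FX Mod ?N"
  have FX: "group ?FX" by (rule free_group_group)
  have N: "?N \<lhd> ?FX" by (rule normal_closure_normal[OF FX S])
  then have \<Gamma>: "group ?\<Gamma>" by (rule normal.factorgroup_is_group)
  obtain k :: nat and T where T: "T \<subseteq> carrier (free_group {1..k})"
    and iso: "?\<Gamma> \<cong> free_group {1..k} Mod normal_closure (free_group {1..k}) T"
    and stable': "weakly_stable_presentation {1..k} (normal_closure (free_group {1..k}) T)"
    using stable unfolding weakly_stable_in_permutations_def by blast
  let ?FY = "free_group {1..k}"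
  let ?M = "normal_closure ?FY T"
  let ?\<Delta> = "?FY Mod ?M"
  have FY: "group ?FY" by (rule free_group_group)
  have M: "?M \<lhd> ?FY" by (rule normal_closure_normal[OF FY T])
  then have \<Delta>: "group ?\<Delta>" by (rule normal.factorgroup_is_group)
  obtain \<alpha> where \<alpha>: "\<alpha> \<in> iso ?\<Gamma> ?\<Delta>" using iso by (auto simp: is_iso_def)
  interpret \<alpha>: group_hom ?\<Gamma> ?\<Delta> \<alpha>
    using \<Gamma> \<Delta> \<alpha> by (intro group_hom.intro group_hom_axioms.intro) (auto simp: iso_def)
  have \<alpha>bij: "bij_betw \<alpha> (carrier ?\<Gamma>) (carrier ?\<Delta>)" using \<alpha> by (simp add: iso_def)
  \<comment> \<open>Composing with the isomorphism \<alpha> puts both presentations over the same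
    group \<Delta>; injectivity of \<alpha> leaves the kernel equal to the original
    relations.\<close>
  define \<pi> where "\<pi> = \<alpha> \<circ> (#>\<^bsub>?FX\<^esub>) ?N"
  have q: "(#>\<^bsub>?FX\<^esub>) ?N \<in> hom ?FX ?\<Gamma>" by (rule normal.r_coset_hom_Mod[OF N])
  have \<pi>: "\<pi> \<in> hom ?FX ?\<Delta>" unfolding \<pi>_def using q \<alpha>.homh by (rule Group.hom_compose)
  have \<pi>surj: "\<pi> ` carrier ?FX = carrier ?\<Delta>"
    using \<alpha>bij unfolding \<pi>_def bij_betw_def by (simp add: carrier_FactGroup image_comp)
  have "\<alpha> x = \<one>\<^bsub>?\<Delta>\<^esub> \<longleftrightarrow> x = \<one>\<^bsub>?\<Gamma>\<^esub>" if "x \<in> carrier ?\<Gamma>" for x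
    using that \<alpha>bij \<alpha>.hom_one \<alpha>.G.one_closed unfolding bij_betw_def by (metis inj_onD)
  moreover have "?N #>\<^bsub>?FX\<^esub> w \<in> carrier ?\<Gamma>" if "w \<in> carrier ?FX" for w
    using that q by (auto simp: hom_def)
  ultimately have "kernel ?FX ?\<Delta> \<pi> = kernel ?FX ?\<Gamma> ((#>\<^bsub>?FX\<^esub>) ?N)"
    unfolding kernel_def \<pi>_def by auto
  then have ker: "kernel ?FX ?\<Delta> \<pi> = ?N" by (simp add: kernel_r_coset[OF FX N])
  have "(#>\<^bsub>?FY\<^esub>) ?M ` carrier ?FY = carrier ?\<Delta>" by (simp add: carrier_FactGroup)
  from weakly_stable_presentation_transfer[OF finX _ \<Delta> \<pi> \<pi>surj normal.r_coset_hom_Mod[OF M] this]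
  show ?thesis
    unfolding ker kernel_r_coset[OF FY M] using stable' by blast
qed


section \<open>Polynomial stability\<close>

text \<open>Words over \<open>X\<close> only read values on \<open>X\<close>. For \<open>X\<close>
  the nontrivial elements of \<open>G\<close>, the value at the unit may therefore be reset.\<close>

lemma strong_approx_cong:
  assumes "\<And>x. x \<in> X \<Longrightarrow> p x = q x"
  shows "strong_approx X R \<delta> m p \<longleftrightarrow> strong_approx X R \<delta> m q"
proof -
  have "word_val H p w = word_val H q w" if "w \<in> carrier (free_group X)"
    for w and H :: "(nat \<Rightarrow> nat) monoid"
    using assms free_group_letters[OF that] by (intro word_val_cong) auto
  then show ?thesis by (simp add: strong_approx_def)
qed

lemma solution_cong:
  assumes "\<And>x. x \<in> X \<Longrightarrow> p x = q x"
  shows "solution X R m p \<longleftrightarrow> solution X R m q"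
proof -
  have "word_val H p w = word_val H q w" if "w \<in> carrier (free_group X)"
    for w and H :: "(nat \<Rightarrow> nat) monoid"
    using assms free_group_letters[OF that] by (intro word_val_cong) auto
  then have "kernel (free_group X) H (word_val H p) = kernel (free_group X) H (word_val H q)"
    for H :: "(nat \<Rightarrow> nat) monoid"
    by (auto simp: kernel_def)
  then show ?thesis using assms by (simp add: solution_def Pi_iff)
qed

lemma unital_polynomial_iff_solution:
  assumes "group G" and q: "unital_map G (sym_group m) q"
  shows "polynomial_map G (sym_group m) s q \<longleftrightarrow>
    solution (carrier G - {\<one>\<^bsub>G\<^esub>}) (pol_relations s G) m q"
  using polynomial_map_iff_kernel[OF assms(1) sym_group_is_group q] q
  by (auto simp: solution_def unital_map_def pol_free_def)

lemma unital_map_update: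
  assumes "p \<in> carrier G - {\<one>\<^bsub>G\<^esub>} \<rightarrow> carrier H" "group H"
  shows "unital_map G H (p(\<one>\<^bsub>G\<^esub> := \<one>\<^bsub>H\<^esub>))"
  using assms by (auto simp: unital_map_def group.is_monoid monoid.one_closed)

text \<open>A tuple on the nontrivial elements becomes a unital map by setting its value at the unit
  to the identity. In both directions the same \<delta> serves.\<close>

lemma weakly_P_stable_iff_presentation:
  assumes G: "group G"
  shows "weakly_P_stable s G \<longleftrightarrow>
    weakly_stable_presentation (carrier G - {\<one>\<^bsub>G\<^esub>}) (pol_relations s G)"
    (is "_ \<longleftrightarrow> weakly_stable_presentation ?X ?R")
proof
  assume L: "weakly_P_stable s G"
  show "weakly_stable_presentation ?X ?R"
    unfolding weakly_stable_presentation_def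
  proof (intro allI impI)
    fix \<epsilon> :: real assume "\<epsilon> > 0"
    then obtain \<delta> where \<delta>: "\<delta> > 0" "\<And>m f. m \<ge> 1 \<Longrightarrow> strong_polynomial_approx s G \<delta> m f \<Longrightarrow>
        \<exists>q. unital_map G (sym_group m) q \<and> polynomial_map G (sym_group m) s q \<and>
          (\<forall>g\<in>carrier G. hamming m (f g) (q g) < \<epsilon>)"
      using L unfolding weakly_P_stable_def by metis
    have "\<exists>q. solution ?X ?R m q \<and> (\<forall>x\<in>?X. hamming m (p x) (q x) < \<epsilon>)"
      if m: "m \<ge> 1" and p: "strong_solution ?X ?R \<delta> m p" for m p
    proof -
      let ?f = "p(\<one>\<^bsub>G\<^esub> := \<one>\<^bsub>sym_group m\<^esub>)"
      have "unital_map G (sym_group m) ?f"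
        using p by (intro unital_map_update sym_group_is_group) (simp add: strong_solution_def)
      moreover have "strong_approx ?X ?R \<delta> m ?f"
        using p strong_approx_cong[of ?X ?f p] by (simp add: strong_solution_def)
      ultimately obtain q where q: "unital_map G (sym_group m) q"
          "polynomial_map G (sym_group m) s q" "\<And>g. g \<in> carrier G \<Longrightarrow> hamming m (?f g) (q g) < \<epsilon>"
        using \<delta>(2)[OF m] unfolding strong_polynomial_approx_def by blast
      have "hamming m (p x) (q x) < \<epsilon>" if "x \<in> ?X" for x
        using q(3)[of x] that by auto
      then show ?thesis
        using q unital_polynomial_iff_solution[OF G q(1)] by blast
    qed
    then show "\<exists>\<delta>>0. \<forall>m\<ge>1. \<forall>p. strong_solution ?X ?R \<delta> m p \<longrightarrow>
        (\<exists>p'. solution ?X ?R m p' \<and> (\<forall>x\<in>?X. hamming m (p x) (p' x) < \<epsilon>))"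
      using \<delta>(1) by blast
  qed
next
  assume R: "weakly_stable_presentation ?X ?R"
  show "weakly_P_stable s G"
    unfolding weakly_P_stable_def
  proof (intro allI impI)
    fix \<epsilon> :: real assume \<epsilon>: "\<epsilon> > 0"
    then obtain \<delta> where \<delta>: "\<delta> > 0" "\<And>m p. m \<ge> 1 \<Longrightarrow> strong_solution ?X ?R \<delta> m p \<Longrightarrow>
        \<exists>q. solution ?X ?R m q \<and> (\<forall>x\<in>?X. hamming m (p x) (q x) < \<epsilon>)"
      using R unfolding weakly_stable_presentation_def by metis
    have "\<exists>q. unital_map G (sym_group m) q \<and> polynomial_map G (sym_group m) s q \<and>
        (\<forall>g\<in>carrier G. hamming m (f g) (q g) < \<epsilon>)"
      if m: "m \<ge> 1" and f: "strong_polynomial_approx s G \<delta> m f" for m f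
    proof -
      have fu: "unital_map G (sym_group m) f" using f by (simp add: strong_polynomial_approx_def)
      then have "strong_solution ?X ?R \<delta> m f"
        using f by (auto simp: strong_polynomial_approx_def strong_solution_def unital_map_def)
      then obtain q where q: "solution ?X ?R m q" "\<And>x. x \<in> ?X \<Longrightarrow> hamming m (f x) (q x) < \<epsilon>"
        using \<delta>(2)[OF m] by blast
      let ?q = "q(\<one>\<^bsub>G\<^esub> := \<one>\<^bsub>sym_group m\<^esub>)"
      have u: "unital_map G (sym_group m) ?q"
        using q by (intro unital_map_update sym_group_is_group) (simp add: solution_def)
      have "solution ?X ?R m ?q"
        using q(1) solution_cong[of ?X ?q q] by simp
      then have "polynomial_map G (sym_group m) s ?q"
        using unital_polynomial_iff_solution[OF G u] by simp
      moreover have "hamming m (f g) (?q g) < \<epsilon>" if "g \<in> carrier G" for g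
      \<comment> \<open>The solution is close to \<open>f\<close> on \<open>?X\<close> only. At the
        unit both maps are the identity, and their distance is 0 because \<open>m\<close> is
        positive.\<close>
      proof (cases "g = \<one>\<^bsub>G\<^esub>")
        case True
        then show ?thesis
          using fu \<epsilon> hamming_refl[OF m, of "\<one>\<^bsub>sym_group m\<^esub>"] sym_group_is_group[of m]
          by (simp add: unital_map_def group.is_monoid monoid.one_closed)
      qed (use q(2) that in auto)
      ultimately show ?thesis using u by blast
    qed
    then show "\<exists>\<delta>>0. \<forall>m\<ge>1. \<forall>f. strong_polynomial_approx s G \<delta> m f \<longrightarrow>
      (\<exists>q. unital_map G (sym_group m) q \<and> polynomial_map G (sym_group m) s q \<and>
        (\<forall>g\<in>carrier G. hamming m (f g) (q g) < \<epsilon>))"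
      using \<delta>(1) by blast
  qed
qed

theorem proposition6p1:
  fixes G :: "('a, 'b) monoid_scheme" and s :: nat
  assumes "group G" and "finite (carrier G)" and "s \<ge> 1"
  shows "weakly_P_stable s G \<longleftrightarrow> weakly_stable_in_permutations (Pol s G)"
proof -
  let ?X = "carrier G - {\<one>\<^bsub>G\<^esub>}"
  have X: "finite ?X" using assms by simp
  have S: "pol_relators s G \<subseteq> carrier (free_group ?X)"
    using pol_relators_closed[OF assms(1)] by (simp add: pol_free_def)
  have "weakly_stable_presentation ?X (pol_relations s G) \<longleftrightarrow>
      weakly_stable_in_permutations (Pol s G)"
    unfolding Pol_def pol_relations_eq pol_free_def
    using stable_presentation_imp_weakly_stable[OF X finite_pol_relators[OF assms(2)] S]
      weakly_stable_imp_stable_presentation[OF X S] by (rule iffI)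
  then show ?thesis by (simp add: weakly_P_stable_iff_presentation[OF assms(1)])
qed

end
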